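(* Let $\Phi:\mathbf{R}^n\to\mathbf{R}^m$ be continuously differentiable and suppose that: (i) the set $V$ is finite; (ii) there exists $M>0$ such that $\|x\|\le M$ for all $x\in\Delta:=\{x\in\mathbf{R}^n:\Phi(x)\preceq_E\Phi(x^0)\}$; (iii) the Jacobian $J\Phi$ is $L$-Lipschitz continuous on an open set $\Omega\supset\Delta$. If Algorithm TT-PRP (defined in the context), started at $x^0\in\mathbf{R}^n$, generates an infinite sequence $\{x^k\}$ (so that $\vartheta(x^k)\ne0$ for all $k\ge0$), then $$\liminf_{k\to\infty}\|\vartheta(x^k)\|=0.$$
   Context: $E\subset\mathbf{R}^m$ is a closed, convex and pointed cone with nonempty interior. It induces the partial order $u_1\preceq_E u_2\Leftrightarrow u_2-u_1\in E$ on $\mathbf{R}^m$. The dual cone is $E^*=\{v\in\mathbf{R}^m:\langle v,z\rangle\ge 0\ \ \forall z\in E\}$. $V\subset E^*\setminus\{0\}$ is a fixed compact set with $\mathrm{cone}(\mathrm{co}(V))=E^*$ ($\mathrm{co}$ is the convex hull, $\mathrm{cone}(\cdot)$ the generated cone). For $u,d\in\mathbf{R}^n$, $\lambda(u,d)=\sup\{\langle J\Phi(u)d,v\rangle:v\in V\}$, where $J\Phi(u)$ is the Jacobian of $\Phi$ at $u$, and $$\vartheta(u)=\arg\min_{d\in\mathbf{R}^n}\ \lambda(u,d)+\tfrac12\|d\|^2$$ (the minimizer exists and is unique). Algorithm TT-PRP. Fix constants $0<\rho<\sigma<1$, $\mu>0$, and $\xi\in E$ with $0<\langle\xi,v\rangle\le1$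 for all $v\in V$. Given $x^0\in\mathbf{R}^n$, stop if $\vartheta(x^0)=0$; otherwise set $d^0=\vartheta(x^0)$. For $k=1,2,\ldots$: choose a step size $\alpha_{k-1}>0$ such that $x^k:=x^{k-1}+\alpha_{k-1}d^{k-1}$ satisfies $$\Phi(x^k)\preceq_E\Phi(x^{k-1})+\rho\,\alpha_{k-1}\lambda(x^{k-1},d^{k-1})\,\xi,$$ $$-\mu\,\lambda(x^{k-1},d^{k-1})\ \ge\ \lambda(x^k,d^{k-1})\ \ge\ \sigma\,\lambda(x^{k-1},d^{k-1}).$$ Stop if $\vartheta(x^k)=0$; otherwise set $$\beta_k=\max\left\{0,\ \frac{-\lambda(x^k,\vartheta(x^k))+\lambda(x^{k-1},\vartheta(x^k))}{-\lambda(x^{k-1},\vartheta(x^{k-1}))}\right\},$$ $$d^k=\vartheta(x^k)+\beta_kd^{k-1}-\beta_k\frac{|\lambda(x^k,d^{k-1})|}{\lambda(x^k,\vartheta(x^k))}\,\vartheta(x^k),$$ and continue with $k+1$. *)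

theory Defs
  imports "HOL-Analysis.Analysis"
begin

definition pointed :: "'a::real_vector set \<Rightarrow> bool" where
  "pointed E \<longleftrightarrow> E \<inter> uminus ` E = {0}"

definition cone_le :: "'a::real_vector set \<Rightarrow> 'a \<Rightarrow> 'a \<Rightarrow> bool" where
  "cone_le E u\<^sub>1 u\<^sub>2 \<longleftrightarrow> u\<^sub>2 - u\<^sub>1 \<in> E"

definition dual_cone :: "'a::real_inner set \<Rightarrow> 'a set" where
  "dual_cone E = {v. \<forall>z\<in>E. 0 \<le> v \<bullet> z}"

(* The supremum is meant for compact nonempty V, where the set of values is nonempty and bounded,
   so that the real-valued SUP is the true supremum. *)
definition lam ::
  "(real^'m) set \<Rightarrow> (real^'n \<Rightarrow> real^'m) \<Rightarrow> real^'n \<Rightarrow> real^'n \<Rightarrow> real" where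
  "lam V \<Phi> u d = (SUP v\<in>V. (jacobian \<Phi> (at u) *v d) \<bullet> v)"

definition vartheta ::
  "(real^'m) set \<Rightarrow> (real^'n \<Rightarrow> real^'m) \<Rightarrow> real^'n \<Rightarrow> real^'n" where
  "vartheta V \<Phi> u = arg_min_on (\<lambda>d. lam V \<Phi> u d + 1/2 * (norm d)\<^sup>2) UNIV"

(* tt_beta V Phi y x is beta_k for the consecutive iterates y = x^(k-1) and x = x^k. *)
definition tt_beta ::
  "(real^'m) set \<Rightarrow> (real^'n \<Rightarrow> real^'m) \<Rightarrow> real^'n \<Rightarrow> real^'n \<Rightarrow> real" where
  "tt_beta V \<Phi> y x =
     max 0 ((- lam V \<Phi> x (vartheta V \<Phi> x) + lam V \<Phi> y (vartheta V \<Phi> x))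
            / (- lam V \<Phi> y (vartheta V \<Phi> y)))"

(* An infinite run of the algorithm: the stopping test vartheta(x^k) = 0 never succeeds.
   The step sizes alpha are not determined by the algorithm; any sequence meeting the line search
   conditions is admitted. The index k here is k - 1 in the usual description. *)
definition tt_prp_run ::
  "(real^'m) set \<Rightarrow> (real^'m) set \<Rightarrow> (real^'n \<Rightarrow> real^'m) \<Rightarrow>
   real \<Rightarrow> real \<Rightarrow> real \<Rightarrow> real^'m \<Rightarrow> real^'n \<Rightarrow>
   (nat \<Rightarrow> real^'n) \<Rightarrow> (nat \<Rightarrow> real^'n) \<Rightarrow> (nat \<Rightarrow> real) \<Rightarrow> bool" where
  "tt_prp_run E V \<Phi> \<rho> \<sigma> \<mu> \<xi> x\<^sub>0 x d \<alpha> \<longleftrightarrow>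
     x 0 = x\<^sub>0 \<and> d 0 = vartheta V \<Phi> (x 0) \<and>
     (\<forall>k. vartheta V \<Phi> (x k) \<noteq> 0) \<and>
     (\<forall>k. \<alpha> k > 0 \<and>
          x (Suc k) = x k + \<alpha> k *\<^sub>R d k \<and>
          cone_le E (\<Phi> (x (Suc k))) (\<Phi> (x k) + (\<rho> * \<alpha> k * lam V \<Phi> (x k) (d k)) *\<^sub>R \<xi>) \<and>
          - \<mu> * lam V \<Phi> (x k) (d k) \<ge> lam V \<Phi> (x (Suc k)) (d k) \<and>
          lam V \<Phi> (x (Suc k)) (d k) \<ge> \<sigma> * lam V \<Phi> (x k) (d k) \<and>
          d (Suc k) =
            vartheta V \<Phi> (x (Suc k))
            + tt_beta V \<Phi> (x k) (x (Suc k)) *\<^sub>R d k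
            - (tt_beta V \<Phi> (x k) (x (Suc k)) * (\<bar>lam V \<Phi> (x (Suc k)) (d k)\<bar>
                 / lam V \<Phi> (x (Suc k)) (vartheta V \<Phi> (x (Suc k))))) *\<^sub>R vartheta V \<Phi> (x (Suc k)))"

end

theory Submission
  imports Defs
begin

text \<open>
  Suppose that the steepest descent directions \<open>\<theta> k = vartheta V \<Phi> (x k)\<close> do not approach \<open>0\<close>
  along any subsequence, so that \<open>norm (\<theta> k) > \<gamma> > 0\<close> for all large \<open>k\<close>. The contradiction is a
  variant of the argument of Gilbert and Nocedal for the nonnegative PRP method.

  Comparing \<open>\<theta> k\<close> with its multiples gives \<open>lam V \<Phi> (x k) (\<theta> k) = - (norm (\<theta> k))\<^sup>2\<close>
  (\<open>lam_vartheta\<close>), and the third term of the search direction is chosen so that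
  \<open>a k = - lam V \<Phi> (x k) (d k) \<ge> (norm (\<theta> k))\<^sup>2\<close> (\<open>tt_prp_descent\<close>). Hence the iterates stay in the
  bounded level set. The lower curvature condition and the Lipschitz bound force long
  enough steps, and the sufficient decrease then gives \<open>a k / norm (d k) \<longlonglongrightarrow> 0\<close>
  (\<open>zoutendijk_limit\<close>). As \<open>a k \<ge> \<gamma>\<^sup>2\<close> eventually, the lengths \<open>norm (d k)\<close> tend to infinity.

  On the other hand they cannot. The multiple of \<open>\<theta> (Suc k)\<close> in \<open>d (Suc k)\<close> is
  negligible in comparison with \<open>norm (d (Suc k))\<close>, and the coefficient of \<open>d k\<close> is nonnegative;
  thus consecutive normalised directions get arbitrarily close (\<open>directions_settle\<close>). Since the
  iterates are bounded, the length of the path over \<open>N\<close> late steps is then at most \<open>4 * M\<close>, whatever \<open>N\<close>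
  is (\<open>window_length_bound\<close>). The PRP coefficient is at most a multiple of the last step
  length, so \<open>norm (d (Suc k)) \<le> C + K * norm (x (Suc k) - x k) * norm (d k)\<close>. Over
  \<open>N\<close> steps the growth factors have a bounded sum; by the inequality of arithmetic and geometric
  means their product is at most \<open>1\<close> if \<open>N\<close> is large, so the lengths do not grow from one window
  to the next (\<open>directions_not_divergent\<close>).
\<close>

section \<open>The support function and the steepest descent direction\<close>

lemma lam_upper:
  assumes "bounded V" "v \<in> V"
  shows "(jacobian \<Phi> (at u) *v d) \<bullet> v \<le> lam V \<Phi> u d"
proof -
  obtain R where R: "\<forall>v\<in>V. norm v \<le> R" using assms(1) bounded_iff by blast
  have "bdd_above ((\<lambda>v. (jacobian \<Phi> (at u) *v d) \<bullet> v) ` V)"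
  proof (rule bdd_aboveI2)
    fix w assume "w \<in> V"
    then show "(jacobian \<Phi> (at u) *v d) \<bullet> w \<le> norm (jacobian \<Phi> (at u) *v d) * R"
      using R norm_cauchy_schwarz[of "jacobian \<Phi> (at u) *v d" w]
        mult_left_mono[of "norm w" R "norm (jacobian \<Phi> (at u) *v d)"] by fastforce
  qed
  then show ?thesis unfolding lam_def using assms(2) by (rule cSUP_upper[rotated])
qed

lemma lam_least:
  assumes "V \<noteq> {}" "\<And>v. v \<in> V \<Longrightarrow> (jacobian \<Phi> (at u) *v d) \<bullet> v \<le> c"
  shows "lam V \<Phi> u d \<le> c"
  unfolding lam_def using assms by (rule cSUP_least)

lemma lam_add_le:
  assumes "bounded V" "V \<noteq> {}"
  shows "lam V \<Phi> u (d + e) \<le> lam V \<Phi> u d + lam V \<Phi> u e"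
  by (rule lam_least[OF assms(2)])
    (simp add: matrix_vector_right_distrib inner_add_left add_mono lam_upper[OF assms(1)])

lemma lam_zero [simp]: "V \<noteq> {} \<Longrightarrow> lam V \<Phi> u 0 = 0"
  by (simp add: lam_def)

lemma lam_scaleR:
  assumes "bounded V" "V \<noteq> {}" "0 \<le> t"
  shows "lam V \<Phi> u (t *\<^sub>R d) = t * lam V \<Phi> u d"
proof (cases "t = 0")
  case False
  with assms(3) have t: "t > 0" by simp
  have le: "lam V \<Phi> u (s *\<^sub>R e) \<le> s * lam V \<Phi> u e" if "s > 0" for s e
    by (rule lam_least[OF assms(2)])
      (use that in \<open>simp add: matrix_vector_mult_scaleR lam_upper[OF assms(1)]\<close>)
  have "lam V \<Phi> u d \<le> inverse t * lam V \<Phi> u (t *\<^sub>R d)"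
    using le[of "inverse t" "t *\<^sub>R d"] t by simp
  with t have "t * lam V \<Phi> u d \<le> lam V \<Phi> u (t *\<^sub>R d)"
    by (simp add: field_simps)
  with le[OF t, of d] show ?thesis by simp
qed (simp add: assms)

lemma lam_diff_bound:
  assumes "V \<noteq> {}" and R: "\<And>v. v \<in> V \<Longrightarrow> norm v \<le> R"
  shows "\<bar>lam V \<Phi> y d - lam V \<Phi> z e\<bar> \<le> R * norm (jacobian \<Phi> (at y) *v d - jacobian \<Phi> (at z) *v e)"
proof -
  have bd: "bounded V" using R bounded_iff by blast
  have "lam V \<Phi> y d \<le> lam V \<Phi> z e + R * norm (jacobian \<Phi> (at y) *v d - jacobian \<Phi> (at z) *v e)"
    for y z d e
  proof (rule lam_least[OF assms(1)])
    fix v assume v: "v \<in> V"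
    let ?a = "jacobian \<Phi> (at y) *v d" and ?b = "jacobian \<Phi> (at z) *v e"
    have "(?a - ?b) \<bullet> v \<le> norm (?a - ?b) * norm v" by (rule norm_cauchy_schwarz)
    also have "\<dots> \<le> norm (?a - ?b) * R" by (rule mult_left_mono) (use R v in auto)
    finally show "?a \<bullet> v \<le> lam V \<Phi> z e + R * norm (?a - ?b)"
      using lam_upper[OF bd v, of \<Phi> z e] by (simp add: inner_diff_left mult.commute)
  qed
  from this[of y d z e] this[of z e y d] show ?thesis
    by (simp add: norm_minus_commute)
qed

text \<open>
  The selection operator in the definition of \<open>vartheta\<close> is only meaningful if a minimiser exists. The
  objective is continuous, because \<open>lam\<close> is Lipschitz in the direction, and coercive, because
  \<open>lam\<close> is bounded below by a multiple of the norm.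
\<close>

lemma vartheta_minimizes:
  fixes \<Phi> :: "real^'n \<Rightarrow> real^'m"
  assumes "bounded V" "V \<noteq> {}"
  shows "lam V \<Phi> u (vartheta V \<Phi> u) + 1/2 * (norm (vartheta V \<Phi> u))\<^sup>2
    \<le> lam V \<Phi> u d + 1/2 * (norm d)\<^sup>2"
proof -
  let ?f = "\<lambda>d. lam V \<Phi> u d + 1/2 * (norm d)\<^sup>2"
  let ?J = "jacobian \<Phi> (at u)"
  obtain R where R: "\<And>v. v \<in> V \<Longrightarrow> norm v \<le> R" using assms(1) bounded_iff by metis
  have "0 \<le> R" using R assms(2) by (metis equals0I norm_ge_zero order_trans)
  define G where "G = R * onorm ((*v) ?J)"
  have J: "norm (?J *v e) \<le> onorm ((*v) ?J) * norm e" for e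
    by (rule onorm[OF matrix_vector_mul_bounded_linear])
  have G0: "0 \<le> G" unfolding G_def using \<open>0 \<le> R\<close>
    by (simp add: onorm_pos_le[OF matrix_vector_mul_bounded_linear])
  have G: "\<bar>lam V \<Phi> u d - lam V \<Phi> u e\<bar> \<le> G * norm (d - e)" for d e
    using lam_diff_bound[OF assms(2) R, of \<Phi> u d u e]
      mult_left_mono[OF J[of "d - e"] \<open>0 \<le> R\<close>]
    by (simp add: G_def matrix_vector_mult_diff_distrib mult.assoc)
  have "continuous_on UNIV (lam V \<Phi> u)"
    by (rule lipschitz_on_continuous_on[of G], rule lipschitz_onI)
      (use G G0 in \<open>auto simp: dist_norm\<close>)
  then have cont: "continuous_on (cball 0 (2 * G)) ?f"
    by (intro continuous_intros) (auto intro: continuous_on_subset)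
  have ne: "cball 0 (2 * G) \<noteq> ({} :: (real^'n) set)" using G0 by simp
  obtain m where m: "\<forall>e\<in>cball 0 (2 * G). ?f m \<le> ?f e"
    using continuous_attains_inf[OF compact_cball ne cont] by (elim bexE) iprover
  \<comment> \<open>outside of the ball the quadratic term dominates, so that the value at the origin wins\<close>
  have "?f m \<le> ?f e" for e
  proof (cases "norm e \<le> 2 * G")
    case False
    have "- lam V \<Phi> u e \<le> G * norm e" using G[of e 0] assms(2) by simp
    moreover have "2 * G * norm e \<le> norm e * norm e"
      by (rule mult_right_mono) (use False in auto)
    ultimately have "0 \<le> ?f e" by (simp add: power2_eq_square)
    then show ?thesis using bspec[OF m, of 0] G0 assms(2) by simp
  qed (use m in auto)
  then have "is_arg_min ?f (\<lambda>d. d \<in> UNIV) m"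
    by (simp add: is_arg_min_linorder)
  then have "is_arg_min ?f (\<lambda>d. d \<in> UNIV) (vartheta V \<Phi> u)"
    unfolding vartheta_def arg_min_on_def arg_min_def by (rule someI)
  then show ?thesis by (simp add: is_arg_min_linorder)
qed

text \<open>
  Along the ray through the minimiser the objective is the quadratic \<open>t * l + t\<^sup>2 * q / 2\<close>, with
  \<open>l\<close> the value of \<open>lam\<close> and \<open>q\<close> the squared norm; its minimum over \<open>t \<ge> 0\<close> is at \<open>t = - l / q\<close>, and
  it has to be at \<open>t = 1\<close>.
\<close>

lemma lam_vartheta:
  assumes "bounded V" "V \<noteq> {}"
  shows "lam V \<Phi> u (vartheta V \<Phi> u) = - (norm (vartheta V \<Phi> u))\<^sup>2"
proof (cases "vartheta V \<Phi> u = 0")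
  case False
  define l where "l = lam V \<Phi> u (vartheta V \<Phi> u)"
  define q where "q = (norm (vartheta V \<Phi> u))\<^sup>2"
  have q: "q > 0" using False by (simp add: q_def)
  have min: "l + q / 2 \<le> t * l + t\<^sup>2 * q / 2" if "0 \<le> t" for t
    using vartheta_minimizes[OF assms, of \<Phi> u "t *\<^sub>R vartheta V \<Phi> u"] that
    by (simp add: lam_scaleR[OF assms] l_def q_def power_mult_distrib)
  have "l < 0" using min[of 0] q by simp
  then have "l + q / 2 \<le> (- l / q) * l + (- l / q)\<^sup>2 * q / 2"
    using q by (intro min) (simp add: divide_nonpos_pos)
  then have "l * q + q\<^sup>2 / 2 \<le> - l\<^sup>2 / 2"
    using q by (simp add: power2_eq_square field_simps)
  then have "(l + q)\<^sup>2 \<le> 0" by (simp add: power2_eq_square algebra_simps)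
  then show ?thesis by (simp add: l_def q_def)
qed (simp add: assms)

section \<open>Divergent search directions along a bounded sequence\<close>

text \<open>
  A nonnegative multiple of \<open>d\<close> is normalised to \<open>sgn d\<close> again, so only \<open>r\<close> can turn the
  direction. The sign condition on \<open>b\<close> is essential: for \<open>r = 0\<close> and \<open>b < 0\<close> the direction is reversed.
\<close>

lemma sgn_diff_le:
  fixes d w r :: "'a::real_normed_vector"
  assumes w: "w = r + b *\<^sub>R d" and b: "0 \<le> b" and "d \<noteq> 0" "w \<noteq> 0"
  shows "norm (sgn w - sgn d) \<le> 2 * (norm r / norm w)"
proof -
  have d: "d = norm d *\<^sub>R sgn d" using \<open>d \<noteq> 0\<close> by (simp add: sgn_div_norm)
  have nd: "norm (sgn d) = 1" using \<open>d \<noteq> 0\<close> by (simp add: norm_sgn)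
  have eq: "norm w *\<^sub>R (sgn w - sgn d) = r + (b * norm d - norm w) *\<^sub>R sgn d"
  proof -
    have "norm w *\<^sub>R (sgn w - sgn d) = w - norm w *\<^sub>R sgn d"
      using \<open>w \<noteq> 0\<close> by (simp add: sgn_div_norm scaleR_diff_right)
    moreover have "w = r + (b * norm d) *\<^sub>R sgn d" using w d by (metis scaleR_scaleR)
    ultimately show ?thesis by (metis add_diff_eq scaleR_diff_left)
  qed
  have "\<bar>b * norm d - norm w\<bar> \<le> norm r"
    using norm_triangle_ineq3[of "b *\<^sub>R d" w] b w by (simp add: norm_minus_commute)
  then have "norm w * norm (sgn w - sgn d) \<le> 2 * norm r"
    using norm_triangle_ineq[of r "(b * norm d - norm w) *\<^sub>R sgn d"] nd
    by (simp flip: eq)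
  then show ?thesis using \<open>w \<noteq> 0\<close> by (simp add: field_simps)
qed

text \<open>
  With \<open>p = norm r / norm d'\<close> the hypothesis on \<open>r\<close> reads
  \<open>p \<le> G / norm d' + q * \<delta>\<close>, where \<open>\<delta>\<close> is the weight of the old direction in the new one.
  Since the two normalised directions are unit vectors, \<open>\<delta> \<le> 1 + p\<close>; hence the
  term with \<open>\<delta>\<close> can be absorbed once \<open>q\<close> is small, and no bound on the ratio of consecutive
  lengths has to be known beforehand.
\<close>

lemma directions_settle:
  fixes d r :: "nat \<Rightarrow> 'a::real_normed_vector" and b q :: "nat \<Rightarrow> real"
  assumes d_Suc: "\<And>k. d (Suc k) = r k + b k *\<^sub>R d k"
    and b0: "\<And>k. 0 \<le> b k" and d0: "\<And>k. d k \<noteq> 0" and q0: "\<And>k. 0 \<le> q k"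
    and q_lim: "q \<longlonglongrightarrow> 0"
    and div: "filterlim (\<lambda>k. norm (d k)) at_top sequentially"
    and r_le: "\<forall>\<^sub>F k in sequentially. norm (r k) \<le> G + q k * (b k * norm (d k))"
  shows "(\<lambda>k. norm (sgn (d (Suc k)) - sgn (d k))) \<longlonglongrightarrow> 0"
proof (rule Lim_null_comparison)
  have "filterlim (\<lambda>k. norm (d (Suc k))) at_infinity sequentially"
    by (rule filterlim_at_top_imp_at_infinity, rule filterlim_compose[OF div filterlim_Suc])
  then have "(\<lambda>k. G / norm (d (Suc k))) \<longlonglongrightarrow> 0" by (rule tendsto_divide_0[OF tendsto_const])
  then show "(\<lambda>k. 4 * (G / norm (d (Suc k)) + q k)) \<longlonglongrightarrow> 0"
    by (intro tendsto_mult_right_zero tendsto_add_zero q_lim)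
  have "\<forall>\<^sub>F k in sequentially. q k < 1/2"
    by (rule order_tendstoD(2)[OF q_lim]) simp
  then show "\<forall>\<^sub>F k in sequentially. norm (norm (sgn (d (Suc k)) - sgn (d k)))
      \<le> 4 * (G / norm (d (Suc k)) + q k)"
    using r_le
  proof eventually_elim
    case (elim k)
    define p where "p = norm (r k) / norm (d (Suc k))"
    define \<delta> where "\<delta> = b k * norm (d k) / norm (d (Suc k))"
    have D: "0 < norm (d (Suc k))" using d0 by simp
    have p: "p \<le> G / norm (d (Suc k)) + q k * \<delta>"
      using D elim(2) by (simp add: p_def \<delta>_def field_simps)
    have "b k * norm (d k) \<le> norm (d (Suc k)) + norm (r k)"
      using norm_triangle_ineq4[of "d (Suc k)" "r k"] b0[of k] by (simp add: d_Suc)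
    then have "\<delta> \<le> 1 + p" using D by (simp add: p_def \<delta>_def field_simps)
    then have "q k * \<delta> \<le> q k * (1 + p)" by (rule mult_left_mono) (rule q0)
    moreover have "q k * p \<le> 1/2 * p"
      using elim(1) by (intro mult_right_mono) (auto simp: p_def)
    ultimately have "p \<le> 2 * (G / norm (d (Suc k)) + q k)"
      using p unfolding distrib_left mult_1_right by linarith
    moreover have "norm (sgn (d (Suc k)) - sgn (d k)) \<le> 2 * p"
      unfolding p_def by (rule sgn_diff_le[OF d_Suc b0 d0 d0])
    ultimately show ?case by simp
  qed
qed

text \<open>
  A bounded sequence of points that moves in a nearly constant direction cannot go far. Over \<open>N\<close>
  consecutive steps, all directions eventually stay within \<open>1/2\<close> of the first one, so at least half
  of the length of the path is net displacement, which is at most \<open>2 * M\<close>.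
\<close>

lemma window_length_bound:
  fixes x d :: "nat \<Rightarrow> 'a::real_normed_vector"
  assumes step: "\<And>k. x (Suc k) = x k + \<alpha> k *\<^sub>R d k" and \<alpha>: "\<And>k. 0 < \<alpha> k"
    and d0: "\<And>k. d k \<noteq> 0"
    and M: "\<And>k. norm (x k) \<le> M"
    and dir: "(\<lambda>k. norm (sgn (d (Suc k)) - sgn (d k))) \<longlonglongrightarrow> 0"
  shows "\<forall>\<^sub>F k in sequentially. (\<Sum>j<N. norm (x (Suc (k + j)) - x (k + j))) \<le> 4 * M"
proof -
  \<comment> \<open>up to \<open>N\<close> changes of direction of size \<open>e\<close> add up to at most \<open>1/2\<close>\<close>
  define e where "e = 1 / (2 * (real N + 1))"
  have "0 < e" by (simp add: e_def)
  then obtain k0 where k0: "\<And>k. k \<ge> k0 \<Longrightarrow> norm (sgn (d (Suc k)) - sgn (d k)) < e"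
    using order_tendstoD(2)[OF dir] unfolding eventually_sequentially by blast
  have near: "norm (sgn (d (k + j)) - sgn (d k)) \<le> real j * e" if "k \<ge> k0" for k j
  proof (induction j)
    case (Suc j)
    have "norm (sgn (d (k + Suc j)) - sgn (d k))
        \<le> norm (sgn (d (Suc (k + j))) - sgn (d (k + j))) + norm (sgn (d (k + j)) - sgn (d k))"
      by (rule order_trans[OF _ norm_triangle_ineq]) simp
    also have "\<dots> \<le> e + real j * e" using Suc k0[of "k + j"] that by simp
    finally show ?case by (simp add: algebra_simps)
  qed simp
  have "(\<Sum>j<N. norm (x (Suc (k + j)) - x (k + j))) \<le> 4 * M" if k: "k \<ge> k0" for k
  proof -
    define s where "s j = norm (x (Suc (k + j)) - x (k + j))" for j
    have s: "x (Suc (k + j)) - x (k + j) = s j *\<^sub>R sgn (d (k + j))" for j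
      using d0 \<alpha>[of "k + j"] by (simp add: s_def step sgn_div_norm)
    let ?S = "\<Sum>j<N. s j"
    have "x (k + N) - x k = (\<Sum>j<N. s j *\<^sub>R sgn (d (k + j)))"
      using sum_lessThan_telescope[of "\<lambda>j. x (k + j)" N] by (simp add: s)
    also have "\<dots> = ?S *\<^sub>R sgn (d k) + (\<Sum>j<N. s j *\<^sub>R (sgn (d (k + j)) - sgn (d k)))"
      by (simp add: scaleR_diff_right sum_subtractf scaleR_sum_left)
    finally have "?S *\<^sub>R sgn (d k)
        = x (k + N) - x k - (\<Sum>j<N. s j *\<^sub>R (sgn (d (k + j)) - sgn (d k)))" by simp
    moreover have "norm (?S *\<^sub>R sgn (d k)) = ?S"
      using d0 by (simp add: norm_sgn s_def sum_nonneg)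
    ultimately have "?S \<le> norm (x (k + N) - x k)
        + norm (\<Sum>j<N. s j *\<^sub>R (sgn (d (k + j)) - sgn (d k)))"
      by (metis norm_triangle_ineq4)
    moreover have "norm (x (k + N) - x k) \<le> 2 * M"
      using norm_triangle_ineq4[of "x (k + N)" "x k"] M[of "k + N"] M[of k] by linarith
    moreover have "norm (\<Sum>j<N. s j *\<^sub>R (sgn (d (k + j)) - sgn (d k))) \<le> (\<Sum>j<N. s j * (1/2))"
    proof (rule sum_norm_le)
      fix j assume "j \<in> {..<N}"
      then have "real j * e \<le> 1/2" by (simp add: e_def field_simps)
      then show "norm (s j *\<^sub>R (sgn (d (k + j)) - sgn (d k))) \<le> s j * (1/2)"
        using mult_left_mono[of _ "1/2" "s j"] near[OF k, of j] by (simp add: s_def)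
    qed
    moreover have "(\<Sum>j<N. s j * (1/2)) = ?S / 2" by (simp add: sum_divide_distrib)
    ultimately have "?S \<le> 4 * M" by linarith
    then show ?thesis by (simp add: s_def)
  qed
  then show ?thesis unfolding eventually_sequentially by blast
qed

text \<open>
  If the lengths diverge, the constant \<open>C\<close> is eventually at most \<open>norm (d k) / N\<close>, and each
  length is at most \<open>1 / N + K * norm (x (Suc k) - x k)\<close> times the one before. The sum of these factors over
  \<open>N\<close> steps is at most \<open>1 + 4 * M * K\<close>. For \<open>N\<close> at least this number, their arithmetic mean is at
  most \<open>1\<close>, and so is their product.
\<close>

lemma directions_not_divergent:
  fixes x d :: "nat \<Rightarrow> 'a::real_normed_vector"
  assumes step: "\<And>k. x (Suc k) = x k + \<alpha> k *\<^sub>R d k" and \<alpha>: "\<And>k. 0 < \<alpha> k"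
    and d0: "\<And>k. d k \<noteq> 0"
    and M: "\<And>k. norm (x k) \<le> M"
    and dir: "(\<lambda>k. norm (sgn (d (Suc k)) - sgn (d k))) \<longlonglongrightarrow> 0"
    and K: "0 \<le> K"
    and growth: "\<forall>\<^sub>F k in sequentially.
      norm (d (Suc k)) \<le> C + K * norm (x (Suc k) - x k) * norm (d k)"
  shows "\<not> filterlim (\<lambda>k. norm (d k)) at_top sequentially"
proof
  assume div: "filterlim (\<lambda>k. norm (d k)) at_top sequentially"
  define N where "N = nat \<lceil>1 + 4 * M * K\<rceil> + 1"
  have N: "0 < N" "1 + 4 * M * K \<le> real N" unfolding N_def by linarith+
  define s where "s k = norm (x (Suc k) - x k)" for k
  have "\<forall>\<^sub>F k in sequentially. C * real N \<le> norm (d k)"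
    using div by (simp add: filterlim_at_top)
  with growth window_length_bound[OF step \<alpha> d0 M dir, of N]
  have "\<forall>\<^sub>F k in sequentially. C * real N \<le> norm (d k)
      \<and> norm (d (Suc k)) \<le> C + K * s k * norm (d k) \<and> (\<Sum>j<N. s (k + j)) \<le> 4 * M"
    unfolding s_def by eventually_elim simp
  then obtain k0 where
    k0: "\<And>k. k \<ge> k0 \<Longrightarrow> C * real N \<le> norm (d k)"
      "\<And>k. k \<ge> k0 \<Longrightarrow> norm (d (Suc k)) \<le> C + K * s k * norm (d k)"
      "\<And>k. k \<ge> k0 \<Longrightarrow> (\<Sum>j<N. s (k + j)) \<le> 4 * M"
    unfolding eventually_sequentially by blast
  \<comment> \<open>\<open>ln t \<le> t - 1\<close> takes the place of the inequality of arithmetic and geometric means\<close>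
  have ln_step: "ln (norm (d (Suc k))) - ln (norm (d k)) \<le> 1 / real N + K * s k - 1"
    if "k \<ge> k0" for k
  proof -
    have p: "0 < norm (d (Suc k))" "0 < norm (d k)" using d0 by auto
    have "C \<le> norm (d k) / real N" using k0(1)[OF that] N(1) by (simp add: field_simps)
    then have "norm (d (Suc k)) \<le> (1 / real N + K * s k) * norm (d k)"
      using k0(2)[OF that] by (simp add: algebra_simps)
    then have "norm (d (Suc k)) / norm (d k) \<le> 1 / real N + K * s k"
      using p by (simp add: pos_divide_le_eq)
    moreover have "ln (norm (d (Suc k)) / norm (d k)) \<le> norm (d (Suc k)) / norm (d k) - 1"
      using p by (intro ln_le_minus_one) simp
    ultimately show ?thesis using p by (simp add: ln_div)
  qed
  have le: "norm (d (k + N)) \<le> norm (d k)" if "k \<ge> k0" for k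
  proof -
    have "ln (norm (d (k + N))) - ln (norm (d k))
        = (\<Sum>j<N. ln (norm (d (Suc (k + j)))) - ln (norm (d (k + j))))"
      using sum_lessThan_telescope[of "\<lambda>j. ln (norm (d (k + j)))" N] by simp
    also have "\<dots> \<le> (\<Sum>j<N. 1 / real N + K * s (k + j) - 1)"
      by (rule sum_mono) (use ln_step that in auto)
    also have "\<dots> = 1 + K * (\<Sum>j<N. s (k + j)) - real N"
      using N(1) by (simp add: sum.distrib sum_subtractf sum_distrib_left)
    also have "\<dots> \<le> 0"
      using mult_left_mono[OF k0(3)[OF that] K] N(2) by (simp add: mult_ac)
    finally show ?thesis using d0 by simp
  qed
  have bound: "norm (d (k0 + i * N)) \<le> norm (d k0)" for i
  proof (induction i)
    case (Suc i)
    then show ?case using le[of "k0 + i * N"] by (simp add: algebra_simps)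
  qed simp
  from div have "\<forall>\<^sub>F k in sequentially. norm (d k0) + 1 \<le> norm (d k)"
    by (simp add: filterlim_at_top)
  then obtain k1 where k1: "\<And>k. k \<ge> k1 \<Longrightarrow> norm (d k0) + 1 \<le> norm (d k)"
    unfolding eventually_sequentially by blast
  have "k1 \<le> k0 + k1 * N" using N(1) by (cases N) auto
  from k1[OF this] bound[of k1] show False by simp
qed


section \<open>Sufficient decrease and the Zoutendijk condition\<close>

text \<open>
  The sequence \<open>f\<close> converges, so its decrements, and with them \<open>\<alpha> k * a k\<close>, tend to \<open>0\<close>; and
  \<open>(a k / D k)\<^sup>2 \<le> B * (\<alpha> k * a k)\<close> by the curvature bound. This is the limit form of the
  condition of Zoutendijk that the squares \<open>(a k / D k)\<^sup>2\<close> are summable.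
\<close>

lemma zoutendijk_limit:
  fixes f a \<alpha> D :: "nat \<Rightarrow> real"
  assumes a: "\<And>k. 0 \<le> a k" and \<alpha>: "\<And>k. 0 < \<alpha> k" and D: "\<And>k. 0 < D k"
    and c: "0 < c" and B: "0 \<le> B"
    and lower: "\<And>k. m \<le> f k"
    and decrease: "\<And>k. f (Suc k) + c * (\<alpha> k * a k) \<le> f k"
    and curvature: "\<And>k. a k \<le> B * \<alpha> k * (D k)\<^sup>2"
  shows "(\<lambda>k. a k / D k) \<longlonglongrightarrow> 0"
proof -
  have pos: "0 \<le> \<alpha> k * a k" for k using a[of k] \<alpha>[of k] by simp
  have "decseq f"
  proof (rule decseq_SucI)
    fix k show "f (Suc k) \<le> f k"
      using decrease[of k] mult_nonneg_nonneg[OF less_imp_le[OF c] pos[of k]] by linarith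
  qed
  then obtain l where l: "f \<longlonglongrightarrow> l" using decseq_convergent lower by metis
  have "(\<lambda>k. B * ((f k - f (Suc k)) / c)) \<longlonglongrightarrow> B * ((l - l) / c)"
    by (intro tendsto_intros l LIMSEQ_Suc) (use c in auto)
  then have "(\<lambda>k. sqrt (B * ((f k - f (Suc k)) / c))) \<longlonglongrightarrow> 0"
    using tendsto_real_sqrt by fastforce
  moreover have "norm (a k / D k) \<le> sqrt (B * ((f k - f (Suc k)) / c))" for k
  proof -
    have "(a k / D k)\<^sup>2 = a k * a k / (D k)\<^sup>2" by (simp add: power2_eq_square)
    also have "\<dots> \<le> a k * (B * \<alpha> k * (D k)\<^sup>2) / (D k)\<^sup>2"
      by (intro divide_right_mono mult_left_mono curvature a) simp
    also have "\<dots> = B * (\<alpha> k * a k)" using D[of k] by simp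
    also have "\<dots> \<le> B * ((f k - f (Suc k)) / c)"
      using decrease[of k] c by (intro mult_left_mono B) (simp add: pos_le_divide_eq mult.commute)
    finally show ?thesis using a[of k] D[of k] by (simp add: real_le_rsqrt)
  qed
  ultimately show ?thesis by (metis (lifting) Lim_null_comparison eventually_sequentiallyI)
qed

section \<open>The three-term PRP iteration\<close>

lemma tt_prp_runD:
  assumes "tt_prp_run E V \<Phi> \<rho> \<sigma> \<mu> \<xi> x\<^sub>0 x d \<alpha>"
  shows "x 0 = x\<^sub>0"
    and "d 0 = vartheta V \<Phi> (x 0)"
    and "vartheta V \<Phi> (x k) \<noteq> 0"
    and "0 < \<alpha> k"
    and "x (Suc k) = x k + \<alpha> k *\<^sub>R d k"
    and "cone_le E (\<Phi> (x (Suc k))) (\<Phi> (x k) + (\<rho> * \<alpha> k * lam V \<Phi> (x k) (d k)) *\<^sub>R \<xi>)"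
    and "lam V \<Phi> (x (Suc k)) (d k) \<le> - \<mu> * lam V \<Phi> (x k) (d k)"
    and "\<sigma> * lam V \<Phi> (x k) (d k) \<le> lam V \<Phi> (x (Suc k)) (d k)"
  using assms unfolding tt_prp_run_def by blast+

text \<open>
  Since \<open>lam\<close> is negative at the steepest descent direction, the third term of the search direction
  is a nonnegative multiple of it. So the direction has the form \<open>r + b *\<^sub>R d\<close> with
  \<open>b \<ge> 0\<close>, for which the bounds on the turning of directions are made.
\<close>

lemma tt_prp_direction:
  assumes "bounded V" "V \<noteq> {}" and run: "tt_prp_run E V \<Phi> \<rho> \<sigma> \<mu> \<xi> x\<^sub>0 x d \<alpha>"
  shows "d (Suc k) =
    (1 + tt_beta V \<Phi> (x k) (x (Suc k)) * \<bar>lam V \<Phi> (x (Suc k)) (d k)\<bar>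
         / (norm (vartheta V \<Phi> (x (Suc k))))\<^sup>2) *\<^sub>R vartheta V \<Phi> (x (Suc k))
    + tt_beta V \<Phi> (x k) (x (Suc k)) *\<^sub>R d k"
proof -
  have "d (Suc k) =
            vartheta V \<Phi> (x (Suc k))
            + tt_beta V \<Phi> (x k) (x (Suc k)) *\<^sub>R d k
            - (tt_beta V \<Phi> (x k) (x (Suc k)) * (\<bar>lam V \<Phi> (x (Suc k)) (d k)\<bar>
                 / lam V \<Phi> (x (Suc k)) (vartheta V \<Phi> (x (Suc k))))) *\<^sub>R vartheta V \<Phi> (x (Suc k))"
    using run unfolding tt_prp_run_def by blast
  then show ?thesis by (simp add: lam_vartheta[OF assms(1,2)] scaleR_add_left)
qed

text \<open>
  By sublinearity the previous direction contributes at most \<open>\<beta> * l\<close>, where \<open>l\<close> is its slope at the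
  new point; the third term contributes \<open>- \<beta> * \<bar>l\<bar>\<close>, which outweighs it whatever the sign of \<open>l\<close>.
\<close>

lemma tt_prp_descent:
  assumes "bounded V" "V \<noteq> {}" and run: "tt_prp_run E V \<Phi> \<rho> \<sigma> \<mu> \<xi> x\<^sub>0 x d \<alpha>"
  shows "lam V \<Phi> (x k) (d k) \<le> - (norm (vartheta V \<Phi> (x k)))\<^sup>2"
proof (cases k)
  case 0
  then show ?thesis by (simp add: tt_prp_runD(2)[OF run] lam_vartheta[OF assms(1,2)])
next
  case (Suc j)
  let ?t = "vartheta V \<Phi> (x k)" and ?b = "tt_beta V \<Phi> (x j) (x k)"
  let ?l = "lam V \<Phi> (x k) (d j)"
  have b: "0 \<le> ?b" by (simp add: tt_beta_def)
  have t: "?t \<noteq> 0" by (rule tt_prp_runD(3)[OF run])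
  have "d k = (1 + ?b * \<bar>?l\<bar> / (norm ?t)\<^sup>2) *\<^sub>R ?t + ?b *\<^sub>R d j"
    unfolding Suc by (rule tt_prp_direction[OF assms])
  then have "lam V \<Phi> (x k) (d k) \<le> (1 + ?b * \<bar>?l\<bar> / (norm ?t)\<^sup>2) * - (norm ?t)\<^sup>2 + ?b * ?l"
    using lam_add_le[OF assms(1,2), of \<Phi> "x k" "(1 + ?b * \<bar>?l\<bar> / (norm ?t)\<^sup>2) *\<^sub>R ?t" "?b *\<^sub>R d j"] b
    by (simp add: lam_scaleR[OF assms(1,2)] lam_vartheta[OF assms(1,2)])
  also have "\<dots> = - (norm ?t)\<^sup>2 + ?b * (?l - \<bar>?l\<bar>)"
    using t by (simp add: field_simps)
  also have "\<dots> \<le> - (norm ?t)\<^sup>2"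
    using mult_nonneg_nonpos[OF b, of "?l - \<bar>?l\<bar>"] by linarith
  finally show ?thesis .
qed

section \<open>Convergence\<close>

theorem theorem4p4:
  fixes E V :: "(real^'m) set"
    and \<Phi> :: "real^'n \<Rightarrow> real^'m"
    and \<rho> \<sigma> \<mu> M L :: real
    and \<xi> :: "real^'m"
    and x\<^sub>0 :: "real^'n"
    and \<Omega> :: "(real^'n) set"
    and x d :: "nat \<Rightarrow> real^'n"
    and \<alpha> :: "nat \<Rightarrow> real"
  assumes "closed E" and "convex E" and "cone E" and "pointed E" and "interior E \<noteq> {}"
    and "compact V" and "V \<subseteq> dual_cone E - {0}"
    and "cone hull (convex hull V) = dual_cone E"
    and "0 < \<rho>" and "\<rho> < \<sigma>" and "\<sigma> < 1" and "\<mu> > 0"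
    and "\<xi> \<in> E" and "\<forall>v\<in>V. 0 < \<xi> \<bullet> v \<and> \<xi> \<bullet> v \<le> 1"
    and "\<forall>u. \<Phi> differentiable (at u)"
    and "continuous_on UNIV (\<lambda>u. jacobian \<Phi> (at u))"
    and "finite V"
    and "M > 0" and "\<forall>y\<in>{y. cone_le E (\<Phi> y) (\<Phi> x\<^sub>0)}. norm y \<le> M"
    and "open \<Omega>" and "{y. cone_le E (\<Phi> y) (\<Phi> x\<^sub>0)} \<subseteq> \<Omega>"
    and "L \<ge> 0"
    and "\<forall>y\<in>\<Omega>. \<forall>z\<in>\<Omega>.
           onorm ((*v) (jacobian \<Phi> (at y) - jacobian \<Phi> (at z))) \<le> L * norm (y - z)"
    and "tt_prp_run E V \<Phi> \<rho> \<sigma> \<mu> \<xi> x\<^sub>0 x d \<alpha>"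
  shows "liminf (\<lambda>k. ereal (norm (vartheta V \<Phi> (x k)))) = 0"
proof (rule ccontr)
  assume liminf: "liminf (\<lambda>k. ereal (norm (vartheta V \<Phi> (x k)))) \<noteq> 0"
  note E = \<open>convex E\<close> \<open>cone E\<close> and run = \<open>tt_prp_run E V \<Phi> \<rho> \<sigma> \<mu> \<xi> x\<^sub>0 x d \<alpha>\<close>
  have bV: "bounded V" using \<open>compact V\<close> by (rule compact_imp_bounded)
  have Vne: "V \<noteq> {}"
  proof
    assume "V = {}"
    then have "cone hull (convex hull V) = {}"
      by (simp add: cone_hull_empty)
    moreover have "0 \<in> dual_cone E" by (simp add: dual_cone_def)
    ultimately show False
      unfolding \<open>cone hull (convex hull V) = dual_cone E\<close> by blast
  qed
  then obtain v where v: "v \<in> V" by blast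
  obtain R where R: "0 < R" "\<And>v. v \<in> V \<Longrightarrow> norm v \<le> R"
    using bV unfolding bounded_pos by blast

  \<comment> \<open>\<open>r k\<close> is the part of \<open>d (Suc k)\<close> along \<open>\<theta> (Suc k)\<close>; \<open>l k\<close> is the slope at the end
    of step \<open>k\<close>, and \<open>a k\<close> the descent at its beginning\<close>
  define \<theta> where "\<theta> k = vartheta V \<Phi> (x k)" for k
  define a where "a k = - lam V \<Phi> (x k) (d k)" for k
  define b where "b k = tt_beta V \<Phi> (x k) (x (Suc k))" for k
  define l where "l k = lam V \<Phi> (x (Suc k)) (d k)" for k
  define r where "r k = (1 + b k * \<bar>l k\<bar> / (norm (\<theta> (Suc k)))\<^sup>2) *\<^sub>R \<theta> (Suc k)" for k
  note x0 = tt_prp_runD(1)[OF run]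
    and \<theta>0 = tt_prp_runD(3)[OF run, folded \<theta>_def]
    and \<alpha> = tt_prp_runD(4)[OF run]
    and step = tt_prp_runD(5)[OF run]
    and d_Suc = tt_prp_direction[OF bV Vne run, folded \<theta>_def b_def l_def, folded r_def]
  have armijo: "cone_le E (\<Phi> (x (Suc k))) (\<Phi> (x k) - (\<rho> * \<alpha> k * a k) *\<^sub>R \<xi>)" for k
    using tt_prp_runD(6)[OF run, of k] by (simp add: a_def)
  have wolfe: "l k \<le> \<mu> * a k" "- \<sigma> * a k \<le> l k" for k
    using tt_prp_runD(7,8)[OF run, of k] by (simp_all add: a_def l_def)
  have lam_\<theta>: "lam V \<Phi> (x k) (\<theta> k) = - (norm (\<theta> k))\<^sup>2" for k
    unfolding \<theta>_def by (rule lam_vartheta[OF bV Vne])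
  have a_ge: "(norm (\<theta> k))\<^sup>2 \<le> a k" for k
    using tt_prp_descent[OF bV Vne run, of k] by (simp add: a_def \<theta>_def)
  have a_pos: "0 < a k" for k
    using a_ge[of k] \<theta>0[of k] by (smt (verit) zero_less_norm_iff zero_less_power)
  have d0: "d k \<noteq> 0" for k 
    using a_pos[of k] lam_zero[OF Vne, of \<Phi> "x k"] by (auto simp: a_def)
  have b0: "0 \<le> b k" for k by (simp add: b_def tt_beta_def)

  have level: "cone_le E (\<Phi> (x k)) (\<Phi> x\<^sub>0)" for k
  proof (induction k)
    case 0
    have "0 \<in> E" using \<open>pointed E\<close> by (auto simp: pointed_def)
    then show ?case by (simp add: x0 cone_le_def)
  next
    case (Suc k)
    have "(\<rho> * \<alpha> k * a k) *\<^sub>R \<xi> \<in> E"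
      using \<open>0 < \<rho>\<close> \<alpha>[of k] a_pos[of k] \<open>\<xi> \<in> E\<close> by (intro mem_cone[OF E(2)]) auto
    then have "(\<Phi> x\<^sub>0 - \<Phi> (x k)) + ((\<Phi> (x k) - (\<rho> * \<alpha> k * a k) *\<^sub>R \<xi> - \<Phi> (x (Suc k)))
        + (\<rho> * \<alpha> k * a k) *\<^sub>R \<xi>) \<in> E"
      using Suc armijo[of k] convex_cone[of E] E unfolding cone_le_def by blast
    then show ?case by (simp add: cone_le_def)
  qed
  have M: "norm (x k) \<le> M" and \<Omega>: "x k \<in> \<Omega>" for k
    using level[of k] \<open>\<forall>y\<in>{y. cone_le E (\<Phi> y) (\<Phi> x\<^sub>0)}. norm y \<le> M\<close>
      \<open>{y. cone_le E (\<Phi> y) (\<Phi> x\<^sub>0)} \<subseteq> \<Omega>\<close> by auto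
  have dx: "norm (x j - x k) \<le> 2 * M" for j k
    using norm_triangle_ineq4[of "x j" "x k"] M[of j] M[of k] by linarith

  \<comment> \<open>the Lipschitz bound is used between iterates only; the segments joining them may leave \<open>\<Omega>\<close>\<close>
  have lam_lip: "\<bar>lam V \<Phi> (x j) w - lam V \<Phi> (x k) w\<bar> \<le> R * L * norm (x j - x k) * norm w"
    for j k w
  proof -
    let ?A = "jacobian \<Phi> (at (x j)) - jacobian \<Phi> (at (x k))"
    have "norm (?A *v w) \<le> onorm ((*v) ?A) * norm w"
      by (rule onorm[OF matrix_vector_mul_bounded_linear])
    also have "\<dots> \<le> L * norm (x j - x k) * norm w"
      using \<Omega> \<open>\<forall>y\<in>\<Omega>. \<forall>z\<in>\<Omega>.
           onorm ((*v) (jacobian \<Phi> (at y) - jacobian \<Phi> (at z))) \<le> L * norm (y - z)\<close>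
      by (intro mult_right_mono) auto
    finally have "R * norm (?A *v w) \<le> R * (L * norm (x j - x k) * norm w)"
      using R(1) by (intro mult_left_mono) auto
    then show ?thesis using lam_diff_bound[OF Vne R(2), of \<Phi> "x j" w "x k" w]
      by (simp add: matrix_vector_mult_diff_rdistrib mult.assoc)
  qed
  define G where "G = R * onorm ((*v) (jacobian \<Phi> (at (x 0)))) + R * L * (2 * M)"
  have G: "\<bar>lam V \<Phi> (x k) w\<bar> \<le> G * norm w" for k w
  proof -
    have "norm (jacobian \<Phi> (at (x 0)) *v w) \<le> onorm ((*v) (jacobian \<Phi> (at (x 0)))) * norm w"
      by (rule onorm[OF matrix_vector_mul_bounded_linear])
    then have "\<bar>lam V \<Phi> (x 0) w\<bar> \<le> R * (onorm ((*v) (jacobian \<Phi> (at (x 0)))) * norm w)"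
      using lam_diff_bound[OF Vne R(2), of \<Phi> "x 0" w "x 0" 0] R(1) Vne
      by (simp add: order_trans[OF _ mult_left_mono])
    moreover have "R * L * norm (x k - x 0) * norm w \<le> R * L * (2 * M) * norm w"
      using R(1) \<open>0 \<le> L\<close> dx by (intro mult_right_mono mult_left_mono) auto
    ultimately show ?thesis using lam_lip[of k w 0]
      by (simp add: G_def algebra_simps)
  qed
  have \<theta>_le: "norm (\<theta> k) \<le> G" for k
    using G[of k "\<theta> k"] \<theta>0[of k] by (simp add: lam_\<theta> power2_eq_square)
  have G0: "0 < G" using \<theta>_le[of 0] \<theta>0[of 0] by (smt (verit) zero_less_norm_iff)

  have "continuous_on (cball 0 M) \<Phi>"
    using \<open>\<forall>u. \<Phi> differentiable (at u)\<close>
    by (meson continuous_at_imp_continuous_on differentiable_imp_continuous_within)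
  then have "bounded (\<Phi> ` cball 0 M)"
    by (intro compact_imp_bounded compact_continuous_image compact_cball)
  then obtain P where "\<forall>z\<in>\<Phi> ` cball 0 M. norm z \<le> P" unfolding bounded_iff by blast
  then have P: "norm (\<Phi> y) \<le> P" if "norm y \<le> M" for y using that by simp
  \<comment> \<open>testing with one \<open>v\<close> turns the decrease of \<open>\<Phi>\<close> in the cone order into that of a real sequence\<close>
  have ad: "(\<lambda>k. a k / norm (d k)) \<longlonglongrightarrow> 0"
  proof (rule zoutendijk_limit)
    show "0 \<le> a k" "0 < \<alpha> k" "0 < norm (d k)" for k using a_pos[of k] \<alpha> d0 by auto
    show "0 < \<rho> * (\<xi> \<bullet> v)" using \<open>0 < \<rho>\<close> v \<open>\<forall>v\<in>V. 0 < \<xi> \<bullet> v \<and> \<xi> \<bullet> v \<le> 1\<close> by simp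
    show "0 \<le> R * L / (1 - \<sigma>)" using R(1) \<open>0 \<le> L\<close> \<open>\<sigma> < 1\<close> by simp
    show "- (P * norm v) \<le> \<Phi> (x k) \<bullet> v" for k
      using Cauchy_Schwarz_ineq2[of "\<Phi> (x k)" v] mult_right_mono[OF P[OF M[of k]], of "norm v"]
      by simp
    show "\<Phi> (x (Suc k)) \<bullet> v + \<rho> * (\<xi> \<bullet> v) * (\<alpha> k * a k) \<le> \<Phi> (x k) \<bullet> v" for k
    proof -
      have "v \<in> dual_cone E" using v \<open>V \<subseteq> dual_cone E - {0}\<close> by blast
      then have "0 \<le> v \<bullet> (\<Phi> (x k) - (\<rho> * \<alpha> k * a k) *\<^sub>R \<xi> - \<Phi> (x (Suc k)))"
        using armijo[of k] by (simp add: dual_cone_def cone_le_def)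
      then show ?thesis by (simp add: inner_diff_right inner_commute mult_ac)
    qed
    show "a k \<le> R * L / (1 - \<sigma>) * \<alpha> k * (norm (d k))\<^sup>2" for k
    proof -
      have "(1 - \<sigma>) * a k \<le> l k - lam V \<Phi> (x k) (d k)"
        using wolfe(2)[of k] by (simp add: a_def algebra_simps)
      also have "\<dots> \<le> R * L * norm (x (Suc k) - x k) * norm (d k)"
        using lam_lip[of "Suc k" "d k" k] by (simp add: l_def)
      also have "\<dots> = R * L * \<alpha> k * (norm (d k))\<^sup>2"
        using \<alpha>[of k] by (simp add: step power2_eq_square)
      finally show ?thesis using \<open>\<sigma> < 1\<close> by (simp add: field_simps)
    qed
  qed

  have "0 \<le> liminf (\<lambda>k. ereal (norm (vartheta V \<Phi> (x k))))"
    by (rule Liminf_bounded) simp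
  with liminf have "0 < liminf (\<lambda>k. ereal (norm (vartheta V \<Phi> (x k))))" by simp
  then obtain \<gamma> where "0 < ereal \<gamma>" "ereal \<gamma> < liminf (\<lambda>k. ereal (norm (vartheta V \<Phi> (x k))))"
    using ereal_dense2 by blast
  then have \<gamma>: "0 < \<gamma>" and "\<forall>\<^sub>F k in sequentially. \<gamma> < norm (\<theta> k)"
    using less_LiminfD unfolding \<theta>_def by fastforce+
  then obtain k0 where k0: "\<And>k. k \<ge> k0 \<Longrightarrow> \<gamma> < norm (\<theta> k)"
    unfolding eventually_sequentially by blast

  \<comment> \<open>\<open>a k\<close> is bounded away from \<open>0\<close>, so \<open>norm (d k)\<close> must absorb the decay of the quotient\<close>
  have div: "filterlim (\<lambda>k. norm (d k)) at_top sequentially"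
  proof -
    have "filterlim (\<lambda>k. inverse (a k / norm (d k))) at_top sequentially"
      using ad a_pos d0 by (intro filterlim_inverse_at_top) auto
    then have "filterlim (\<lambda>k. \<gamma>\<^sup>2 * inverse (a k / norm (d k))) at_top sequentially"
      using \<gamma> by (intro filterlim_tendsto_pos_mult_at_top[OF tendsto_const]) auto
    moreover have "\<forall>\<^sub>F k in sequentially. \<gamma>\<^sup>2 * inverse (a k / norm (d k)) \<le> norm (d k)"
    proof (rule eventually_sequentiallyI)
      fix k assume "k0 \<le> k"
      then have "\<gamma>\<^sup>2 \<le> a k"
        using k0[of k] \<gamma> a_ge[of k] by (meson less_imp_le order_trans power_mono)
      then have "\<gamma>\<^sup>2 * norm (d k) \<le> a k * norm (d k)" by (intro mult_right_mono) auto
      then show "\<gamma>\<^sup>2 * inverse (a k / norm (d k)) \<le> norm (d k)"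
        using a_pos[of k] by (simp add: field_simps)
    qed
    ultimately show ?thesis by (rule filterlim_at_top_mono)
  qed

  \<comment> \<open>Both curvature conditions together bound \<open>\<bar>l k\<bar>\<close> by a multiple of
    \<open>a k = o(norm (d k))\<close>; hence \<open>r k\<close> is bounded up to a vanishing fraction of
    \<open>b k * norm (d k)\<close>.\<close>
  define q where "q k = (\<mu> + 1) / \<gamma> * (a k / norm (d k))" for k
  have q_eq: "(\<mu> + 1) * a k / \<gamma> = q k * norm (d k)" for k using d0[of k] by (simp add: q_def)
  have q0: "0 \<le> q k" for k using \<open>\<mu> > 0\<close> \<gamma> a_pos[of k] by (simp add: q_def)
  have r_le: "norm (r k) \<le> G + q k * (b k * norm (d k))" if "k \<ge> k0" for k
  proof -
    have "- a k \<le> - \<sigma> * a k" using \<open>\<sigma> < 1\<close> a_pos[of k] by simp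
    then have "- a k \<le> l k" using wolfe(2)[of k] by (rule order_trans)
    moreover have "0 \<le> \<mu> * a k" using \<open>\<mu> > 0\<close> a_pos[of k] by simp
    ultimately have "\<bar>l k\<bar> \<le> (\<mu> + 1) * a k"
      using wolfe(1)[of k] a_pos[of k] by (simp add: distrib_right abs_le_iff)
    moreover have "\<gamma> \<le> norm (\<theta> (Suc k))" using k0[of "Suc k"] that by simp
    ultimately have "\<bar>l k\<bar> / norm (\<theta> (Suc k)) \<le> (\<mu> + 1) * a k / \<gamma>"
      using \<gamma> by (intro frac_le) (auto intro: order_trans[OF abs_ge_zero])
    then have "b k * (\<bar>l k\<bar> / norm (\<theta> (Suc k))) \<le> b k * ((\<mu> + 1) * a k / \<gamma>)"
      by (intro mult_left_mono b0)
    moreover have "norm (r k) = norm (\<theta> (Suc k)) + b k * (\<bar>l k\<bar> / norm (\<theta> (Suc k)))"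
      using \<theta>0[of "Suc k"] b0[of k] by (simp add: r_def power2_eq_square field_simps)
    ultimately have "norm (r k) \<le> G + b k * ((\<mu> + 1) * a k / \<gamma>)"
      using \<theta>_le[of "Suc k"] by linarith
    then show ?thesis unfolding q_eq by (simp only: mult_ac)
  qed
  have q_lim: "q \<longlonglongrightarrow> 0"
    unfolding q_def by (rule tendsto_mult_right_zero[OF ad])
  have dir: "(\<lambda>k. norm (sgn (d (Suc k)) - sgn (d k))) \<longlonglongrightarrow> 0"
  proof (rule directions_settle[OF d_Suc b0 d0 q0 q_lim div])
    show "\<forall>\<^sub>F k in sequentially. norm (r k) \<le> G + q k * (b k * norm (d k))"
      using r_le by (rule eventually_sequentiallyI)
  qed

  \<comment> \<open>the property that distinguishes PRP among the conjugate gradient coefficients: \<open>b k\<close> is small after a short step\<close>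
  have b_le: "b k \<le> R * L * G / \<gamma>\<^sup>2 * norm (x (Suc k) - x k)" if "k \<ge> k0" for k
  proof -
    have "- lam V \<Phi> (x (Suc k)) (\<theta> (Suc k)) + lam V \<Phi> (x k) (\<theta> (Suc k))
        \<le> R * L * norm (x (Suc k) - x k) * norm (\<theta> (Suc k))"
      using lam_lip[of "Suc k" "\<theta> (Suc k)" k] by linarith
    also have "\<dots> \<le> R * L * norm (x (Suc k) - x k) * G"
      using R(1) \<open>0 \<le> L\<close> by (intro mult_left_mono \<theta>_le) auto
    finally have num: "- lam V \<Phi> (x (Suc k)) (\<theta> (Suc k)) + lam V \<Phi> (x k) (\<theta> (Suc k))
        \<le> R * L * G * norm (x (Suc k) - x k)" by (simp add: mult_ac)
    have pos: "0 \<le> R * L * G * norm (x (Suc k) - x k)" using R(1) \<open>0 \<le> L\<close> G0 by simp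
    have "\<gamma>\<^sup>2 \<le> (norm (\<theta> k))\<^sup>2" using k0[OF that] \<gamma> by (intro power_mono) auto
    then have "(- lam V \<Phi> (x (Suc k)) (\<theta> (Suc k)) + lam V \<Phi> (x k) (\<theta> (Suc k))) / (norm (\<theta> k))\<^sup>2
        \<le> R * L * G * norm (x (Suc k) - x k) / \<gamma>\<^sup>2"
      using num pos \<gamma> by (intro frac_le) auto
    then show ?thesis using pos by (simp add: b_def tt_beta_def lam_\<theta> flip: \<theta>_def)
  qed
  \<comment> \<open>the factor \<open>2\<close> bounds \<open>1 + q k\<close>\<close>
  define K where "K = 2 * (R * L * G / \<gamma>\<^sup>2)"
  have "\<forall>\<^sub>F k in sequentially. norm (d (Suc k)) \<le> G + K * norm (x (Suc k) - x k) * norm (d k)"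
  proof -
    have "\<forall>\<^sub>F k in sequentially. q k < 1"
      by (rule order_tendstoD(2)[OF q_lim]) simp
    then show ?thesis using eventually_ge_at_top[of k0]
    proof eventually_elim
      case (elim k)
      have "norm (d (Suc k)) \<le> norm (r k) + b k * norm (d k)"
        using norm_triangle_ineq[of "r k" "b k *\<^sub>R d k"] b0[of k] by (simp add: d_Suc)
      also have "\<dots> \<le> G + (1 + q k) * (b k * norm (d k))"
        using r_le[OF elim(2)] by (simp add: distrib_right)
      also have "\<dots> \<le> G + 2 * (b k * norm (d k))"
        using elim(1) b0[of k] by (intro add_left_mono mult_right_mono) auto
      also have "\<dots> \<le> G + K * norm (x (Suc k) - x k) * norm (d k)"
        using mult_right_mono[OF b_le[OF elim(2)], of "norm (d k)"] by (simp add: K_def)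
      finally show ?case .
    qed
  qed
  moreover have "0 \<le> K" using R(1) \<open>0 \<le> L\<close> G0 by (simp add: K_def)
  ultimately show False using directions_not_divergent[OF step \<alpha> d0 M dir] div by blast
qed

end
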